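(* Let $X,\partial X$ be Banach spaces and let $A:D(A)\subseteq X\to X$ and $L:D(A)\to\partial X$ be linear operators such that (G1) the restriction $A_0:=A|_{\ker(L)}$, $D(A_0):=\ker(L)$, is closed and densely defined in $X$ and has non-empty resolvent set; (G2) $L:D(A)\to\partial X$ is surjective; (G3) the operator $\binom AL:D(A)\subseteq X\to X\times\partial X$, $u\mapsto(Au,Lu)$, is closed. Let $\mathcal A$ be the operator on $\mathcal X:=X\times\partial X$ given by $$\mathcal A\binom uv:=\binom{Au}{0},\qquad D(\mathcal A):=\left\{\binom uv\in D(A)\times\partial X: Lu=v\right\}.$$ Then the following conditions are equivalent. (a) $(\mathcal A,D(\mathcal A))$ generates a strongly continuous semigroup on $\mathcal X$. (b) $(A_0,D(A_0))$ generates a strongly continuous semigroup on $X$. If (a) holds, the semigroup $(\mathcal T(t))_{t\ge0}$ generated by $\mathcal A$ is given by $$\mathcal T(t)=\begin{pmatrix}T(t)&Q(t)\\0&I_{\partial X}\end{pmatrix}\qquad\text{for all }t\ge0,$$ where $(T(t))_{t\ge0}$ is the semigroup generated by $A_0$ and $Q(t)v=(\lambda-A_0)\int_0^tT(s)\mathcal D_\lambda v\,ds$ for $v\in\partial X$ and any $\lambda\in\rho(A_0)$. In the particular case where $A_0$ is invertible, $(\mathcal T(t))_{t\ge0}$ is given by $$\mathcal T(t)=\begin{pmatrix}T(t)&(I_X-T(t))\mathcal D_0\\0&I_{\partial X}\end{pmatrix}.$$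
   Context: Under (G1)-(G3), for every $\lambda\in\rho(A_0)$ the restriction $L|_{\ker(\lambda-A)}:\ker(\lambda-A)\to\partial X$ is bijective; its inverse $\mathcal D_\lambda:=(L|_{\ker(\lambda-A)})^{-1}:\partial X\to\ker(\lambda-A)\subseteq X$ is called the Dirichlet operator and is bounded. The operators $(\lambda-A_0)\int_0^tT(s)\mathcal D_\lambda\cdot\,ds$ from $\partial X$ to $X$ do not depend on the choice of $\lambda\in\rho(A_0)$ and are denoted by $Q(t)$. "$A_0$ invertible" means $0\in\rho(A_0)$. *)

theory Defs
  imports "HOL-Analysis.Analysis"
begin

text \<open>
  Normed spaces over a scalar field of type \<open>'k::real_normed_field\<close>, i.e. over the real or the
  complex numbers. The distribution only has a type class for real normed spaces, so the scalar
  multiplication is an explicit parameter; it is required to extend the real one and to be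
  compatible with the norm. Completeness comes from the class \<open>banach\<close> of the underlying type.
\<close>

locale normed_space_over = vector_space scale
  for scale :: "'k::real_normed_field \<Rightarrow> 'x::real_normed_vector \<Rightarrow> 'x" +
  assumes scale_of_real: "scale (of_real r) x = r *\<^sub>R x"
    and norm_scale: "norm (scale c x) = norm c * norm x"

lemma normed_space_over_scaleR:
  "normed_space_over (scaleR :: real \<Rightarrow> 'x::real_normed_vector \<Rightarrow> 'x)"
  by unfold_locales (auto simp: algebra_simps)

lemma normed_space_over_mult:
  "normed_space_over ((*) :: complex \<Rightarrow> complex \<Rightarrow> complex)"
  by unfold_locales (auto simp: algebra_simps norm_mult scaleR_conv_of_real)

lemma normed_space_over_prod:
  fixes sX :: "'k::real_normed_field \<Rightarrow> 'x::real_normed_vector \<Rightarrow> 'x"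
    and sY :: "'k \<Rightarrow> 'y::real_normed_vector \<Rightarrow> 'y"
  assumes "normed_space_over sX" and "normed_space_over sY"
  shows "normed_space_over (module_prod.scale sX sY)"
proof -
  interpret X: normed_space_over sX by fact
  interpret Y: normed_space_over sY by fact
  interpret P: vector_space_prod sX sY ..
  show ?thesis
  proof
    fix r and x :: "'x \<times> 'y"
    show "P.scale (of_real r) x = r *\<^sub>R x"
      by (cases x) (simp add: X.scale_of_real Y.scale_of_real P.scale_prod)
  next
    fix c :: "'k" and x :: "'x \<times> 'y"
    obtain u v where x: "x = (u, v)"
      by (cases x)
    have "(norm c * norm u)\<^sup>2 + (norm c * norm v)\<^sup>2 = (norm c)\<^sup>2 * ((norm u)\<^sup>2 + (norm v)\<^sup>2)"
      by (simp add: power_mult_distrib algebra_simps)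
    then show "norm (P.scale c x) = norm c * norm x"
      by (simp add: x P.scale_prod norm_Pair X.norm_scale Y.norm_scale real_sqrt_mult)
  qed
qed

text \<open>
  A (partially defined) operator is given by its domain \<open>D\<close> and a total function \<open>A\<close> whose values
  outside \<open>D\<close> are irrelevant.
\<close>

definition linear_operator ::
    "('k::real_normed_field \<Rightarrow> 'x::real_normed_vector \<Rightarrow> 'x) \<Rightarrow>
     ('k \<Rightarrow> 'y::real_normed_vector \<Rightarrow> 'y) \<Rightarrow> 'x set \<Rightarrow> ('x \<Rightarrow> 'y) \<Rightarrow> bool"
  where "linear_operator sX sY D A \<longleftrightarrow>
    module.subspace sX D \<and>
    (\<forall>u\<in>D. \<forall>v\<in>D. A (u + v) = A u + A v) \<and>
    (\<forall>c. \<forall>u\<in>D. A (sX c u) = sY c (A u))"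

definition closed_operator ::
    "'x::real_normed_vector set \<Rightarrow> ('x \<Rightarrow> 'y::real_normed_vector) \<Rightarrow> bool"
  where "closed_operator D A \<longleftrightarrow> closed ((\<lambda>u. (u, A u)) ` D)"

definition operator_kernel :: "'x set \<Rightarrow> ('x \<Rightarrow> 'y::zero) \<Rightarrow> 'x set"
  where "operator_kernel D A = {u \<in> D. A u = 0}"

definition bounded_operator ::
    "('k::real_normed_field \<Rightarrow> 'x::real_normed_vector \<Rightarrow> 'x) \<Rightarrow>
     ('k \<Rightarrow> 'y::real_normed_vector \<Rightarrow> 'y) \<Rightarrow> ('x \<Rightarrow> 'y) \<Rightarrow> bool"
  where "bounded_operator sX sY B \<longleftrightarrow>
    Vector_Spaces.linear sX sY B \<and> (\<exists>K. \<forall>x. norm (B x) \<le> K * norm x)"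

definition resolvent_set ::
    "('k::real_normed_field \<Rightarrow> 'x::real_normed_vector \<Rightarrow> 'x) \<Rightarrow> 'x set \<Rightarrow> ('x \<Rightarrow> 'x) \<Rightarrow> 'k set"
  where "resolvent_set sX D A =
    {\<mu>. bij_betw (\<lambda>u. sX \<mu> u - A u) D UNIV \<and>
        bounded_operator sX sX (the_inv_into D (\<lambda>u. sX \<mu> u - A u))}"

text \<open>Only the values \<open>T t\<close> for \<open>t \<ge> 0\<close> matter.\<close>

definition C0_semigroup ::
    "('k::real_normed_field \<Rightarrow> 'x::real_normed_vector \<Rightarrow> 'x) \<Rightarrow> (real \<Rightarrow> 'x \<Rightarrow> 'x) \<Rightarrow> bool"
  where "C0_semigroup sX T \<longleftrightarrow>
    (\<forall>t\<ge>0. bounded_operator sX sX (T t)) \<and>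
    (\<forall>x. T 0 x = x) \<and>
    (\<forall>s\<ge>0. \<forall>t\<ge>0. \<forall>x. T (s + t) x = T s (T t x)) \<and>
    (\<forall>x. continuous_on {0..} (\<lambda>t. T t x))"

definition generates ::
    "('k::real_normed_field \<Rightarrow> 'x::real_normed_vector \<Rightarrow> 'x) \<Rightarrow>
     'x set \<Rightarrow> ('x \<Rightarrow> 'x) \<Rightarrow> (real \<Rightarrow> 'x \<Rightarrow> 'x) \<Rightarrow> bool"
  where "generates sX D A T \<longleftrightarrow>
    C0_semigroup sX T \<and>
    D = {x. \<exists>y. ((\<lambda>h. (T h x - x) /\<^sub>R h) \<longlongrightarrow> y) (at_right 0)} \<and>
    (\<forall>x\<in>D. ((\<lambda>h. (T h x - x) /\<^sub>R h) \<longlongrightarrow> A x) (at_right 0))"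

definition dirichlet_operator ::
    "('k::real_normed_field \<Rightarrow> 'x::real_normed_vector \<Rightarrow> 'x) \<Rightarrow>
     'x set \<Rightarrow> ('x \<Rightarrow> 'x) \<Rightarrow> ('x \<Rightarrow> 'y) \<Rightarrow> 'k \<Rightarrow> 'y \<Rightarrow> 'x"
  where "dirichlet_operator sX D A L \<mu> = the_inv_into (operator_kernel D (\<lambda>u. sX \<mu> u - A u)) L"

text \<open>The restriction of \<open>L\<close> inverted here is indeed bijective.\<close>

lemma bij_betw_dirichlet:
  assumes "normed_space_over sX" and "normed_space_over sY"
    and A: "linear_operator sX sX D A" and L: "linear_operator sX sY D L"
    and surj: "L ` D = UNIV"
    and res: "\<mu> \<in> resolvent_set sX (operator_kernel D L) A"
  shows "bij_betw L (operator_kernel D (\<lambda>u. sX \<mu> u - A u)) UNIV"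
proof -
  interpret X: normed_space_over sX by fact
  interpret Y: normed_space_over sY by fact
  define R where "R = (\<lambda>u. sX \<mu> u - A u)"
  have sub: "X.subspace D" and addA: "\<And>u v. u \<in> D \<Longrightarrow> v \<in> D \<Longrightarrow> A (u + v) = A u + A v"
    and addL: "\<And>u v. u \<in> D \<Longrightarrow> v \<in> D \<Longrightarrow> L (u + v) = L u + L v"
    using A L by (auto simp: linear_operator_def)
  have diff: "u - v \<in> D \<and> R (u - v) = R u - R v \<and> L (u - v) = L u - L v"
    if "u \<in> D" "v \<in> D" for u v
  proof -
    have uv: "u - v \<in> D"
      using sub that by (rule X.subspace_diff)
    show ?thesis
      using uv addA[OF uv that(2)] addL[OF uv that(2)]
      by (auto simp: R_def X.scale_right_diff_distrib)
  qed
  have bij: "bij_betw R (operator_kernel D L) UNIV"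
    using res by (simp add: resolvent_set_def R_def)
  have zero: "0 \<in> D" "R 0 = 0" "L 0 = 0"
    using X.subspace_0[OF sub] diff[of 0 0] by auto
  have "inj_on L (operator_kernel D R)"
  proof
    fix u v assume uv: "u \<in> operator_kernel D R" "v \<in> operator_kernel D R" "L u = L v"
    then have "u - v \<in> operator_kernel D L" "R (u - v) = R 0" "0 \<in> operator_kernel D L"
      using diff[of u v] zero by (auto simp: operator_kernel_def)
    then have "u - v = 0"
      using bij by (meson bij_betw_def inj_onD)
    then show "u = v" by simp
  qed
  moreover have "v \<in> L ` operator_kernel D R" for v
  proof -
    obtain u where u: "u \<in> D" "L u = v"
      using surj by (metis UNIV_I imageE)
    obtain w where w: "w \<in> operator_kernel D L" "R w = R u"
      using bij by (metis UNIV_I bij_betw_def imageE)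
    have "u - w \<in> operator_kernel D R" "L (u - w) = v"
      using diff[of u w] u w by (auto simp: operator_kernel_def)
    then show ?thesis by blast
  qed
  ultimately show ?thesis
    unfolding R_def[symmetric] bij_betw_def by auto
qed

definition matrix_domain :: "'x set \<Rightarrow> ('x \<Rightarrow> 'y) \<Rightarrow> ('x \<times> 'y) set"
  where "matrix_domain D L = {(u, v). u \<in> D \<and> L u = v}"

definition matrix_operator :: "('x \<Rightarrow> 'x) \<Rightarrow> 'x \<times> 'y \<Rightarrow> 'x \<times> 'y::zero"
  where "matrix_operator A = (\<lambda>(u, v). (A u, 0))"

end

theory Submission
  imports Defs
begin

text \<open>
  If \<open>A\<^sub>0\<close> generates \<open>T\<close>, then
  \<open>Q(t)v = D\<^sub>\<mu> v - T(t) D\<^sub>\<mu> v + \<mu> \<integral>\<^sub>0\<^sup>t T(s) D\<^sub>\<mu> v ds\<close>, and this formula makes sense without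
  \<open>A\<^sub>0\<close>. The difference quotient at \<open>0\<close> of the resulting matrix semigroup at \<open>(u, v)\<close> is that of \<open>T\<close>
  at \<open>u - D\<^sub>\<mu> v\<close> plus a term converging to \<open>\<mu> D\<^sub>\<mu> v\<close>, and \<open>u - D\<^sub>\<mu> v\<close> lies in the kernel of \<open>L\<close> exactly
  when \<open>L u = v\<close>; hence its generator is the operator matrix. Conversely, the second row of the
  operator matrix vanishes, so a semigroup generated by it leaves second components fixed and in
  particular restricts to \<open>X \<times> {0}\<close>, where its generator is \<open>A\<^sub>0\<close>. A semigroup is
  determined by its generator, so the formula holds for every semigroup generated by the matrix.
\<close>

subsection \<open>Consequences of the Baire category theorem\<close>

text \<open>
  Zabreiko's lemma. The closed graph theorem is the case \<open>p x = norm (f x)\<close>, and the uniform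
  boundedness principle the case \<open>p x = (SUP i. norm (F i x))\<close>.
\<close>

lemma countably_subadditive_imp_bounded:
  fixes p :: "'a::banach \<Rightarrow> real"
  assumes add: "\<And>x y. p (x + y) \<le> p x + p y"
    and scale: "\<And>r x. p (r *\<^sub>R x) = \<bar>r\<bar> * p x"
    and count: "\<And>x s. x sums s \<Longrightarrow> summable (\<lambda>n. p (x n)) \<Longrightarrow> p s \<le> (\<Sum>n. p (x n))"
  shows "\<exists>K. \<forall>x. p x \<le> K * norm x"
proof -
  have p0: "p 0 = 0" using scale[of 0 0] by simp
  have uminus: "p (- x) = p x" for x using scale[of "-1" x] by simp
  have nonneg: "0 \<le> p x" for x using add[of x "- x"] p0 uminus[of x] by simp
  define C where "C n = closure {x. p x \<le> real n}" for n :: nat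
  \<comment> \<open>Since \<open>p\<close> is real-valued, the closed sets \<open>C n\<close> cover
    the whole Banach space, so by Baire they cannot all have empty interior.\<close>
  obtain n where "interior (C n) \<noteq> {}"
  proof (rule ccontr)
    assume "\<not> thesis"
    then have empty: "interior (C n) = {}" for n using that by blast
    have "euclidean interior_of \<Union>(range C) = {}"
    proof (rule Baire_category_alt)
      show "completely_metrizable_space (euclidean :: 'a topology) \<or>
          locally_compact_space (euclidean :: 'a topology) \<and> regular_space (euclidean :: 'a topology)"
        using completely_metrizable_space_euclidean by blast
    qed (use empty in \<open>auto simp: C_def\<close>)
    moreover have "x \<in> \<Union>(range C)" for x
    proof -
      obtain n where "p x \<le> real n" using real_arch_simple by blast
      then show ?thesis unfolding C_def using closure_subset by fastforce
    qed
    then have "\<Union>(range C) = UNIV" by blast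
    ultimately show False by simp
  qed
  then obtain a r where r: "r > 0" and ball: "ball a r \<subseteq> C n"
    using mem_interior by blast
  \<comment> \<open>Moves the ball from \<open>a\<close> to \<open>0\<close>: if \<open>y1\<close>
    is near \<open>a + z\<close> and \<open>y2\<close> near \<open>a - z\<close>, half their
    difference is near \<open>z\<close>, and subadditivity with \<open>p (- x) = p x\<close> keeps
    \<open>p\<close> at most \<open>n\<close> there.\<close>
  have approx: "\<exists>y. p y \<le> real n \<and> norm (y - z) < e" if z: "norm z < r" and e: "e > 0" for z e
  proof -
    have "a + z \<in> C n" "a - z \<in> C n" using z ball by (auto simp: dist_norm)
    then obtain y1 y2 where y1: "p y1 \<le> real n" "norm (y1 - (a + z)) < e"
      and y2: "p y2 \<le> real n" "norm (y2 - (a - z)) < e"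
      using e unfolding C_def closure_approachable dist_norm by (metis (mono_tags) mem_Collect_eq)
    define y where "y = (1/2) *\<^sub>R (y1 + - y2)"
    have "y - z = (1/2) *\<^sub>R ((y1 - (a + z)) - (y2 - (a - z)))"
      by (simp add: y_def algebra_simps flip: scaleR_2)
    then have "norm (y - z) = (1/2) * norm ((y1 - (a + z)) - (y2 - (a - z)))"
      by simp
    also have "\<dots> < e"
      using norm_triangle_ineq4[of "y1 - (a + z)" "y2 - (a - z)"] y1 y2 by simp
    finally have "norm (y - z) < e" .
    moreover have "p y \<le> real n"
      using add[of y1 "- y2"] y1 y2 by (simp add: y_def scale uminus)
    ultimately show ?thesis by blast
  qed
  \<comment> \<open>Scaling constant: a nonzero \<open>x\<close> will be rescaled to norm
    \<open>r / 2\<close> by \<open>k = r / (2 * norm x)\<close>, and \<open>n / k\<close> is then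
    exactly \<open>c * norm x\<close>.\<close>
  define c where "c = 2 * real n / r"
  have approx': "\<exists>y. p y \<le> c * norm x \<and> norm (x - y) < e" if e: "e > 0" for x e
  proof (cases "x = 0")
    case True
    then show ?thesis using e p0 by (intro exI[of _ 0]) simp
  next
    case False
    define k where "k = r / (2 * norm x)"
    have k: "k > 0" using r False by (simp add: k_def)
    have "norm (k *\<^sub>R x) < r" using False r by (simp add: k_def)
    then obtain y where y: "p y \<le> real n" "norm (y - k *\<^sub>R x) < e * k"
      using approx[of "k *\<^sub>R x" "e * k"] e k by auto
    have "x - y /\<^sub>R k = - ((y - k *\<^sub>R x) /\<^sub>R k)" using k by (simp add: algebra_simps)
    then have "norm (x - y /\<^sub>R k) = norm (y - k *\<^sub>R x) / k" using k
      by (simp add: divide_inverse mult.commute)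
    then have 1: "norm (x - y /\<^sub>R k) < e" using y k by (simp add: pos_divide_less_eq)
    have "p (y /\<^sub>R k) = p y / k" using k by (simp add: scale divide_inverse mult.commute)
    also have "\<dots> \<le> real n / k" using y k by (simp add: divide_right_mono)
    also have "\<dots> = c * norm x" using r by (simp add: k_def c_def)
    finally show ?thesis using 1 by blast
  qed
  define f where "f x e = (SOME y. p y \<le> c * norm x \<and> norm (x - y) < e)" for x e
  have f: "p (f x e) \<le> c * norm x" "norm (x - f x e) < e" if "e > 0" for x e
    using someI_ex[OF approx'[OF that, of x]] unfolding f_def by auto
  have c: "c \<ge> 0" using r by (simp add: c_def)
  have "p x \<le> 2 * c * norm x" for x
  proof (cases "x = 0")
    case True
    then show ?thesis using p0 by simp
  next
    case False
    \<comment> \<open>Successive approximation: \<open>rem k\<close> is what is left of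
      \<open>x\<close> after \<open>k\<close> approximants. The tolerances are positive because
      \<open>x\<close> is nonzero, and halving them makes the values of \<open>p\<close> at the
      approximants geometrically summable.\<close>
    define rem where "rem = rec_nat x (\<lambda>k z. z - f z (norm x / 2 ^ Suc k))"
    have rem0: "rem 0 = x" and remS: "rem (Suc k) = rem k - f (rem k) (norm x / 2 ^ Suc k)" for k
      by (simp_all add: rem_def)
    define y where "y k = f (rem k) (norm x / 2 ^ Suc k)" for k
    have rem: "norm (rem k) \<le> norm x / 2 ^ k" for k
    proof (cases k)
      case (Suc j)
      then show ?thesis using f(2)[of "norm x / 2 ^ Suc j" "rem j"] False by (simp add: remS)
    qed (simp add: rem0)
    have py: "p (y k) \<le> c * norm x * (1/2) ^ k" for k
    proof -
      have "p (y k) \<le> c * norm (rem k)" unfolding y_def by (rule f(1)) (use False in simp)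
      also have "\<dots> \<le> c * (norm x / 2 ^ k)" using rem c by (rule mult_left_mono)
      finally show ?thesis by (simp add: power_divide)
    qed
    have "(\<Sum>k<m. y k) = x - rem m" for m
      by (induction m) (simp_all add: rem0 remS y_def)
    moreover have "rem \<longlonglongrightarrow> 0"
    proof (rule Lim_null_comparison)
      show "\<forall>\<^sub>F k in sequentially. norm (rem k) \<le> norm x * (1/2) ^ k"
        using rem by (simp add: power_divide)
      show "(\<lambda>k. norm x * (1/2) ^ k) \<longlonglongrightarrow> 0"
        by (intro tendsto_mult_right_zero LIMSEQ_power_zero) simp
    qed
    ultimately have sums: "y sums x"
      unfolding sums_def using tendsto_diff[of "\<lambda>_. x" x sequentially rem 0] by simp
    have geo: "(\<lambda>k. c * norm x * (1/2) ^ k) sums (c * norm x * 2)"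
      using sums_mult[OF geometric_sums[of "1/2 :: real"], of "c * norm x"] by simp
    have summ: "summable (\<lambda>k. p (y k))"
      by (rule summable_comparison_test'[OF sums_summable[OF geo], of 0]) (use py nonneg in auto)
    have "p x \<le> (\<Sum>k. p (y k))" by (rule count[OF sums summ])
    also have "\<dots> \<le> c * norm x * 2"
      using suminf_le[OF py summ sums_summable[OF geo]] sums_unique[OF geo] by simp
    finally show ?thesis by (simp add: ac_simps)
  qed
  then show ?thesis by blast
qed

text \<open>If a series converges and its images converge absolutely, the pairs of partial sums
  converge in the product, and closedness of the graph identifies the limit of the images. This is
  the countable subadditivity of \<open>norm (f x)\<close>.\<close>

lemma closed_graph_theorem:
  fixes f :: "'a::banach \<Rightarrow> 'b::banach"
  assumes lin: "linear f" and closed: "closed (range (\<lambda>x. (x, f x)))"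
  shows "bounded_linear f"
proof -
  interpret linear f by fact
  have "\<exists>K. \<forall>x. norm (f x) \<le> K * norm x"
  proof (rule countably_subadditive_imp_bounded)
    fix x s assume x: "x sums s" and summ: "summable (\<lambda>n. norm (f (x n)))"
    have "(\<lambda>n. (\<Sum>k<n. x k, f (\<Sum>k<n. x k))) \<longlonglongrightarrow> (s, \<Sum>n. f (x n))"
      using x summable_LIMSEQ[OF summable_norm_cancel[OF summ]]
      by (auto simp: sum sums_def intro!: tendsto_Pair)
    then have "(s, \<Sum>n. f (x n)) \<in> range (\<lambda>x. (x, f x))"
      by (rule closed_sequentially[OF closed, rotated]) auto
    then show "norm (f s) \<le> (\<Sum>n. norm (f (x n)))"
      using summable_norm[OF summ] by auto
  qed (auto simp: add scale norm_triangle_ineq)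
  then show ?thesis using lin
    by (metis bounded_linear.intro bounded_linear_axioms.intro mult.commute)
qed

text \<open>Each \<open>F i\<close> passes through convergent series by continuity, so the countable
  subadditivity of every \<open>norm (F i x)\<close> survives in the supremum.\<close>

lemma uniform_boundedness:
  fixes F :: "'i \<Rightarrow> 'a::banach \<Rightarrow> 'b::banach"
  assumes lin: "\<And>i. i \<in> I \<Longrightarrow> bounded_linear (F i)"
    and pointwise: "\<And>x. bounded ((\<lambda>i. F i x) ` I)"
  obtains M where "M \<ge> 0" "\<And>i x. i \<in> I \<Longrightarrow> norm (F i x) \<le> M * norm x"
proof (cases "I = {}")
  case True
  then show thesis using that[of 0] by simp
next
  case False
  \<comment> \<open>The index set is nonempty in this case, as a supremum of reals requires; the
    pointwise bounds make it an upper bound.\<close>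
  define p where "p x = (SUP i\<in>I. norm (F i x))" for x
  have bdd: "bdd_above ((\<lambda>i. norm (F i x)) ` I)" for x
    using pointwise[of x] unfolding bounded_iff bdd_above_def by auto
  have le_p: "norm (F i x) \<le> p x" if "i \<in> I" for i x
    unfolding p_def using that bdd by (rule cSUP_upper)
  have p_le: "p x \<le> b" if "\<And>i. i \<in> I \<Longrightarrow> norm (F i x) \<le> b" for x b
    unfolding p_def using False that by (rule cSUP_least)
  have scale_le: "p (r *\<^sub>R x) \<le> \<bar>r\<bar> * p x" for r x
  proof (rule p_le)
    fix i assume i: "i \<in> I"
    interpret bounded_linear "F i" using lin i .
    show "norm (F i (r *\<^sub>R x)) \<le> \<bar>r\<bar> * p x"
      using le_p[OF i, of x] by (simp add: scale mult_left_mono)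
  qed
  have "\<exists>K. \<forall>x. p x \<le> K * norm x"
  proof (rule countably_subadditive_imp_bounded)
    show "p (x + y) \<le> p x + p y" for x y
    proof (rule p_le)
      fix i assume i: "i \<in> I"
      interpret bounded_linear "F i" using lin i .
      show "norm (F i (x + y)) \<le> p x + p y"
        using le_p[OF i, of x] le_p[OF i, of y] norm_triangle_ineq[of "F i x" "F i y"]
        by (simp add: add)
    qed
    \<comment> \<open>For nonzero \<open>r\<close> the reverse inequality is \<open>scale_le\<close>
      for \<open>inverse r\<close> at \<open>r *\<^sub>R x\<close>.\<close>
    show "p (r *\<^sub>R x) = \<bar>r\<bar> * p x" for r x
    proof (cases "r = 0")
      case True
      obtain i where i: "i \<in> I" using False by blast
      have "0 \<le> p 0" using le_p[OF i, of 0] norm_ge_zero order_trans by blast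
      then show ?thesis using scale_le[of 0 x] True by simp
    next
      case False
      then show ?thesis
        using scale_le[of r x] scale_le[of "inverse r" "r *\<^sub>R x"] by (simp add: field_simps)
    qed
    fix x s assume x: "x sums s" and summ: "summable (\<lambda>n. p (x n))"
    show "p s \<le> (\<Sum>n. p (x n))"
    proof (rule p_le)
      fix i assume i: "i \<in> I"
      interpret bounded_linear "F i" using lin i .
      have n: "summable (\<lambda>n. norm (F i (x n)))"
        by (rule summable_comparison_test'[OF summ, of 0]) (use le_p[OF i] in auto)
      have "F i s = (\<Sum>n. F i (x n))" using sums_unique[OF sums[OF x]] .
      then have "norm (F i s) \<le> (\<Sum>n. norm (F i (x n)))" using summable_norm[OF n] by simp
      also have "\<dots> \<le> (\<Sum>n. p (x n))" by (rule suminf_le[OF le_p[OF i] n summ])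
      finally show "norm (F i s) \<le> (\<Sum>n. p (x n))" .
    qed
  qed
  then obtain K where K: "p x \<le> K * norm x" for x by blast
  show thesis
  \<comment> \<open>\<open>K\<close> may be negative when the space is trivial.\<close>
  proof (rule that[of "max K 0"])
    fix i x assume "i \<in> I"
    then have "norm (F i x) \<le> K * norm x" using le_p K order_trans by blast
    also have "\<dots> \<le> max K 0 * norm x" by (simp add: mult_right_mono)
    finally show "norm (F i x) \<le> max K 0 * norm x" .
  qed simp
qed

subsection \<open>Strongly continuous semigroups\<close>

text \<open>With one-sided derivatives the mean value theorem is replaced by a first-exit argument:
  the bound \<open>norm (f s - f a) \<le> e * (s - a)\<close> has no first point of failure, because
  a small right derivative carries it a bit further.\<close>

lemma right_derivative_zero_constant:
  fixes f :: "real \<Rightarrow> 'a::real_normed_vector"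
  assumes "a \<le> b" and cont: "continuous_on {a..b} f"
    and deriv: "\<And>s. a \<le> s \<Longrightarrow> s < b \<Longrightarrow> ((\<lambda>h. (f (s + h) - f s) /\<^sub>R h) \<longlongrightarrow> 0) (at_right 0)"
  shows "f b = f a"
proof -
  have le: "norm (f b - f a) \<le> e * (b - a)" if e: "e > 0" for e
  proof (rule ccontr)
    \<comment> \<open>\<open>g\<close> is the excess over the line of slope \<open>e\<close>,
      \<open>B\<close> the set where it is positive, and \<open>m\<close> the exit time.\<close>
    define g where "g s = norm (f s - f a) - e * (s - a)" for s
    define B where "B = {s \<in> {a..b}. g s > 0}"
    define m where "m = Inf B"
    assume "\<not> ?thesis"
    then have b: "b \<in> B" using \<open>a \<le> b\<close> by (auto simp: B_def g_def)
    have bdd: "bdd_below B" by (auto simp: B_def intro!: bdd_belowI[of _ a])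
    have m: "a \<le> m" "m \<le> b"
      unfolding m_def using b bdd by (auto simp: B_def intro: cInf_greatest cInf_lower)
    have below: "g s \<le> 0" if "a \<le> s" "s < m" for s
      using that m cInf_lower[OF _ bdd, of s] by (force simp: B_def m_def not_less)
    have contg: "continuous_on {a..b} g"
      unfolding g_def by (intro continuous_intros cont)
    \<comment> \<open>The bound still holds at \<open>m\<close>: the excess vanishes at
      \<open>a\<close>, and elsewhere it is the limit from the left of nonpositive values.\<close>
    have gm: "g m \<le> 0"
    proof (cases "m = a")
      case True
      then show ?thesis by (simp add: g_def)
    next
      case False
      then have "a < m" using m by simp
      then have "continuous_on {a..m} g" using contg m by (auto elim: continuous_on_subset)
      then have "(g \<longlongrightarrow> g m) (at_left m)"
        using at_within_Icc_at_left[OF \<open>a < m\<close>] m(1) unfolding continuous_on_def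
        by (metis atLeastAtMost_iff order_refl)
      moreover have "\<forall>\<^sub>F s in at_left m. g s \<le> 0"
        using eventually_at_left_real[OF \<open>a < m\<close>] by eventually_elim (use below in auto)
      ultimately show ?thesis by (intro tendsto_upperbound[of g "g m" "at_left m" 0]) auto
    qed
    then have "m < b" using b m by (cases "m = b") (auto simp: B_def)
    have "\<forall>\<^sub>F h in at_right 0. norm ((f (m + h) - f m) /\<^sub>R h) < e"
      using tendstoD[OF deriv[OF m(1) \<open>m < b\<close>] e] by simp
    then obtain d where d: "d > 0" "\<And>h. 0 < h \<Longrightarrow> h < d \<Longrightarrow> norm ((f (m + h) - f m) /\<^sub>R h) < e"
      unfolding eventually_at_right_field by auto
    \<comment> \<open>The bound extends to all points below \<open>m + d\<close>, which contradicts
      \<open>m\<close> being the infimum of \<open>B\<close>.\<close>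
    have good: "g s \<le> 0" if s: "a \<le> s" "s < m + d" for s
    proof (cases "s \<le> m")
      case True
      then show ?thesis using below[OF s(1)] gm by (cases "s = m") auto
    next
      case False
      define h where "h = s - m"
      have h: "0 < h" "h < d" "s = m + h" using False s by (auto simp: h_def)
      have "norm (f s - f m) / h < e"
        using d(2)[OF h(1,2)] h by (simp add: divide_inverse mult.commute)
      then have "norm (f s - f m) \<le> e * h"
        using h by (simp add: pos_divide_less_eq)
      then have "norm (f s - f a) \<le> e * h + norm (f m - f a)"
        using norm_triangle_ineq[of "f s - f m" "f m - f a"] by simp
      then show ?thesis using gm h by (simp add: g_def algebra_simps)
    qed
    have "m + d \<le> Inf B"
      by (rule cInf_greatest) (use b good in \<open>force simp: B_def not_less\<close>)+
    then show False using d by (simp add: m_def)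
  qed
  have "norm (f b - f a) \<le> 0"
  proof (rule field_le_epsilon)
    fix e :: real assume e: "e > 0"
    \<comment> \<open>The summand \<open>1\<close> keeps the denominator positive when
      \<open>a = b\<close>.\<close>
    have "norm (f b - f a) \<le> e / (b - a + 1) * (b - a)"
      using \<open>a \<le> b\<close> e by (intro le) auto
    also have "\<dots> \<le> e" using \<open>a \<le> b\<close> e by (simp add: field_simps)
    finally show "norm (f b - f a) \<le> 0 + e" by simp
  qed
  then show ?thesis by simp
qed

text \<open>The graph of the generator as a relation, so that membership in the domain and the value
  there are handled together.\<close>

definition has_generator_value :: "(real \<Rightarrow> 'x::real_normed_vector \<Rightarrow> 'x) \<Rightarrow> 'x \<Rightarrow> 'x \<Rightarrow> bool"
  where "has_generator_value T x y \<longleftrightarrow> ((\<lambda>h. (T h x - x) /\<^sub>R h) \<longlongrightarrow> y) (at_right 0)"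

locale strongly_continuous_semigroup =
  fixes T :: "real \<Rightarrow> 'x::banach \<Rightarrow> 'x"
  assumes bounded_linear: "t \<ge> 0 \<Longrightarrow> bounded_linear (T t)"
    and zero [simp]: "T 0 x = x"
    and plus: "s \<ge> 0 \<Longrightarrow> t \<ge> 0 \<Longrightarrow> T (s + t) x = T s (T t x)"
    and continuous: "continuous_on {0..} (\<lambda>t. T t x)"
begin

lemma has_generator_value_unique: "has_generator_value T x y \<Longrightarrow> has_generator_value T x z \<Longrightarrow> y = z"
  unfolding has_generator_value_def by (rule tendsto_unique[OF trivial_limit_at_right_real])

text \<open>Each orbit over \<open>{0..t}\<close> is compact, hence bounded; uniform boundedness
  makes the bound independent of the vector.\<close>

lemma locally_bounded:
  obtains M where "M \<ge> 0" "\<And>s x. s \<in> {0..t} \<Longrightarrow> norm (T s x) \<le> M * norm x"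
proof (rule uniform_boundedness[of "{0..t}" T])
  show "bounded_linear (T s)" if "s \<in> {0..t}" for s using that bounded_linear by simp
  show "bounded ((\<lambda>s. T s x) ` {0..t})" for x
    by (intro compact_imp_bounded compact_continuous_image continuous_on_subset[OF continuous]) auto
qed (use that in blast)

lemma continuous_orbit: "0 \<le> a \<Longrightarrow> continuous_on {a..b} (\<lambda>t. T t x)"
  by (rule continuous_on_subset[OF continuous]) auto

lemma integrable_orbit: "0 \<le> a \<Longrightarrow> (\<lambda>t. T t x) integrable_on {a..b}"
  by (intro integrable_continuous_real continuous_orbit)

lemma integral_combine_orbit:
  "0 \<le> a \<Longrightarrow> a \<le> b \<Longrightarrow> b \<le> c \<Longrightarrow>
    integral {a..b} (\<lambda>t. T t x) + integral {b..c} (\<lambda>t. T t x) = integral {a..c} (\<lambda>t. T t x)"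
  by (rule Henstock_Kurzweil_Integration.integral_combine) (auto intro: integrable_orbit)

text \<open>The bounded operator \<open>T h\<close> passes under the integral, where the semigroup
  law turns it into a shift of time.\<close>

lemma apply_integral:
  assumes "0 \<le> h" "0 \<le> a"
  shows "T h (integral {a..b} (\<lambda>s. T s x)) = integral {a + h..b + h} (\<lambda>s. T s x)"
proof -
  have "((\<lambda>s. T s x) has_integral integral {a + h..b + h} (\<lambda>s. T s x)) (cbox (a + h) (b + h))"
    using assms integrable_orbit[of "a + h" x "b + h"] by (simp add: integrable_integral)
  then have "((\<lambda>s. T (h + s) x) has_integral integral {a + h..b + h} (\<lambda>s. T s x)) {a..b}"
    using has_integral_shift_cbox_iff[of "\<lambda>s. T s x" h _ a b] by (simp add: o_def)
  then have *: "((\<lambda>s. T h (T s x)) has_integral integral {a + h..b + h} (\<lambda>s. T s x)) {a..b}"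
    by (rule has_integral_eq[rotated]) (use assms in \<open>auto simp: plus\<close>)
  have "((\<lambda>s. T h (T s x)) has_integral T h (integral {a..b} (\<lambda>s. T s x))) {a..b}"
    using has_integral_linear[OF integrable_integral[OF integrable_orbit] bounded_linear] assms
    by (simp add: o_def)
  then show ?thesis using * by (rule has_integral_unique)
qed

text \<open>The fundamental theorem of calculus for the continuous orbit, taken from the
  right.\<close>

lemma tendsto_average:
  assumes "0 \<le> t"
  shows "((\<lambda>h. integral {t..t + h} (\<lambda>s. T s x) /\<^sub>R h) \<longlongrightarrow> T t x) (at_right 0)"
proof -
  let ?I = "\<lambda>u. integral {t..u} (\<lambda>s. T s x)"
  have "(?I has_vector_derivative T t x) (at t within {t..t + 1})"
    using assms by (intro integral_has_vector_derivative continuous_orbit) auto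
  then have "((\<lambda>u. (?I u - ?I t - (u - t) *\<^sub>R T t x) /\<^sub>R norm (u - t)) \<longlongrightarrow> 0) (at_right t)"
    using at_within_Icc_at_right[of t "t + 1"]
    by (simp add: has_vector_derivative_def has_derivative_at_within)
  then have "((\<lambda>h. (?I (h + t) - h *\<^sub>R T t x) /\<^sub>R norm h) \<longlongrightarrow> 0) (at_right 0)"
    by (subst (asm) filterlim_at_right_to_0) simp
  moreover have "(?I (h + t) - h *\<^sub>R T t x) /\<^sub>R norm h = ?I (t + h) /\<^sub>R h - T t x" if "h > 0" for h
    using that by (simp add: scaleR_diff_right add.commute)
  ultimately have "((\<lambda>h. ?I (t + h) /\<^sub>R h - T t x) \<longlongrightarrow> 0) (at_right 0)"
    by (elim Lim_transform_eventually) (simp add: eventually_mono[OF eventually_at_right_less[of 0]])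
  then show ?thesis by (rule LIM_zero_cancel)
qed

lemma continuous_on_integral_orbit: "continuous_on {0..} (\<lambda>t. integral {0..t} (\<lambda>s. T s x))"
  unfolding continuous_on_eq_continuous_within
proof
  fix t :: real assume t: "t \<in> {0..}"
  \<comment> \<open>Continuity at \<open>t\<close> is local, so the half-line may be exchanged for a
    compact interval.\<close>
  have "at t within {0..} = at t within {0..t + 1}"
    by (rule at_within_nhd[of t "{..<t + 1}"]) auto
  moreover have "continuous_on {0..t + 1} (\<lambda>t. integral {0..t} (\<lambda>s. T s x))"
    by (intro indefinite_integral_continuous_1 integrable_orbit) simp
  ultimately show "continuous (at t within {0..}) (\<lambda>t. integral {0..t} (\<lambda>s. T s x))"
    using t by (simp add: continuous_on_eq_continuous_within)
qed

lemma bounded_linear_integral_orbit: "bounded_linear (\<lambda>x. integral {0..t} (\<lambda>s. T s x))"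
proof -
  have lin: "linear (T s)" if "s \<in> {0..t}" for s
    using that bounded_linear bounded_linear.linear by auto
  obtain M where M: "M \<ge> 0" "\<And>s x. s \<in> {0..t} \<Longrightarrow> norm (T s x) \<le> M * norm x"
    using locally_bounded by blast
  show ?thesis
  proof (rule bounded_linear_intro)
    fix x y
    show "integral {0..t} (\<lambda>s. T s (x + y)) =
        integral {0..t} (\<lambda>s. T s x) + integral {0..t} (\<lambda>s. T s y)"
      by (subst integral_add[symmetric])
        (auto intro!: integrable_orbit Henstock_Kurzweil_Integration.integral_cong
          simp: linear_add[OF lin])
    have "integral {0..t} (\<lambda>s. T s (r *\<^sub>R x)) = integral {0..t} (\<lambda>s. r *\<^sub>R T s x)" for r
      by (rule Henstock_Kurzweil_Integration.integral_cong) (simp add: linear_scale[OF lin])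
    then show "integral {0..t} (\<lambda>s. T s (r *\<^sub>R x)) = r *\<^sub>R integral {0..t} (\<lambda>s. T s x)" for r
      by simp
    \<comment> \<open>For negative \<open>t\<close> the interval is empty and the integral is
      \<open>0\<close>, hence \<open>max t 0\<close>.\<close>
    show "norm (integral {0..t} (\<lambda>s. T s x)) \<le> norm x * (M * max t 0)"
    proof (cases "0 \<le> t")
      case True
      have "norm (integral {0..t} (\<lambda>s. T s x)) \<le> M * norm x * (t - 0)"
        using True M by (intro integral_bound continuous_orbit) auto
      then show ?thesis using True by (simp add: ac_simps)
    qed simp
  qed
qed

text \<open>\<open>T h\<close> shifts the interval of integration by \<open>h\<close>, so only the
  two end pieces survive in the difference, and their averages converge. That orbit integrals lie in
  the domain of the generator is what gives \<open>Q(t)\<close> a meaning.\<close>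

lemma has_generator_value_integral:
  assumes t: "0 \<le> t"
  shows "has_generator_value T (integral {0..t} (\<lambda>s. T s x)) (T t x - x)"
  unfolding has_generator_value_def
proof (rule Lim_transform_eventually)
  let ?I = "\<lambda>a b. integral {a..b} (\<lambda>s. T s x)"
  show "((\<lambda>h. ?I t (t + h) /\<^sub>R h - ?I 0 (0 + h) /\<^sub>R h) \<longlongrightarrow> T t x - x) (at_right 0)"
    using tendsto_diff[OF tendsto_average[OF t] tendsto_average[of 0]] by simp
  have "?I t (t + h) /\<^sub>R h - ?I 0 (0 + h) /\<^sub>R h = (T h (?I 0 t) - ?I 0 t) /\<^sub>R h" if "h > 0" for h
  proof -
    have "?I 0 h + ?I h (t + h) = ?I 0 t + ?I t (t + h)"
      using t that by (simp add: integral_combine_orbit)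
    moreover have "T h (?I 0 t) = ?I h (t + h)" using apply_integral[of h 0 t] that by simp
    ultimately have "T h (?I 0 t) - ?I 0 t = ?I t (t + h) - ?I 0 h"
      by (simp add: algebra_simps)
    then show ?thesis by (simp add: scaleR_diff_right)
  qed
  then show "\<forall>\<^sub>F h in at_right 0.
      ?I t (t + h) /\<^sub>R h - ?I 0 (0 + h) /\<^sub>R h = (T h (?I 0 t) - ?I 0 t) /\<^sub>R h"
    by (simp add: eventually_at_right_less eventually_mono[OF eventually_at_right_less[of 0]])
qed

text \<open>\<open>T t\<close> is continuous and commutes with \<open>T h\<close>, so it can be
  applied to the difference quotients.\<close>

lemma has_generator_value_orbit:
  assumes "has_generator_value T x y" and t: "0 \<le> t"
  shows "has_generator_value T (T t x) (T t y)"
proof -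
  interpret Tt: bounded_linear "T t" using t by (rule bounded_linear)
  have "((\<lambda>h. T t ((T h x - x) /\<^sub>R h)) \<longlongrightarrow> T t y) (at_right 0)"
    using assms(1) unfolding has_generator_value_def by (rule Tt.tendsto)
  moreover have "T t ((T h x - x) /\<^sub>R h) = (T h (T t x) - T t x) /\<^sub>R h" if "h > 0" for h
    using that t plus[of t h x] plus[of h t x] by (simp add: Tt.scale Tt.diff add.commute)
  ultimately show ?thesis
    unfolding has_generator_value_def
    by (elim Lim_transform_eventually) (simp add: eventually_mono[OF eventually_at_right_less[of 0]])
qed

text \<open>Averages of an orbit over \<open>{0..h}\<close> lie in the domain and tend to the
  initial vector.\<close>

lemma dense_generator_domain: "closure {x. \<exists>y. has_generator_value T x y} = UNIV"
proof -
  have "x \<in> closure {x. \<exists>y. has_generator_value T x y}" for x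
  proof (rule Lim_in_closed_set[OF closed_closure _ trivial_limit_at_right_real])
    show "((\<lambda>h. integral {0..0 + h} (\<lambda>s. T s x) /\<^sub>R h) \<longlongrightarrow> x) (at_right 0)"
      using tendsto_average[of 0 x] by simp
    have "\<exists>y. has_generator_value T (integral {0..0 + h} (\<lambda>s. T s x) /\<^sub>R h) y" if "h > 0" for h
    proof -
      let ?w = "integral {0..h} (\<lambda>s. T s x)"
      have "((\<lambda>k. inverse h *\<^sub>R ((T k ?w - ?w) /\<^sub>R k)) \<longlongrightarrow> inverse h *\<^sub>R (T h x - x)) (at_right 0)"
        using has_generator_value_integral[of h x] that unfolding has_generator_value_def by (intro tendsto_intros) auto
      moreover have "inverse h *\<^sub>R ((T k ?w - ?w) /\<^sub>R k) = (T k (?w /\<^sub>R h) - ?w /\<^sub>R h) /\<^sub>R k" if "k > 0" for k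
      proof -
        interpret Tk: bounded_linear "T k" using that by (intro bounded_linear) simp
        show ?thesis by (simp add: Tk.scale algebra_simps)
      qed
      ultimately have "has_generator_value T (?w /\<^sub>R h) (inverse h *\<^sub>R (T h x - x))"
        unfolding has_generator_value_def
        by (elim Lim_transform_eventually) (simp add: eventually_mono[OF eventually_at_right_less[of 0]])
      then show ?thesis by auto
    qed
    then show "\<forall>\<^sub>F h in at_right 0.
        integral {0..0 + h} (\<lambda>s. T s x) /\<^sub>R h \<in> closure {x. \<exists>y. has_generator_value T x y}"
      by (intro eventually_mono[OF eventually_at_right_less[of 0]] subsetD[OF closure_subset]) blast
  qed
  then show ?thesis by blast
qed

end

text \<open>For \<open>x\<close> in the domain of the generator of \<open>S\<close>, a path joining
  \<open>T t x\<close> to \<open>S t x\<close> is constant; density of that domain and continuity of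
  \<open>T t\<close> and \<open>S t\<close> cover the remaining vectors.\<close>

lemma semigroup_determined_by_generator:
  assumes "strongly_continuous_semigroup T" "strongly_continuous_semigroup S"
    and gen: "\<And>x y. has_generator_value S x y \<Longrightarrow> has_generator_value T x y"
    and t: "0 \<le> t"
  shows "T t x = S t x"
proof -
  interpret T: strongly_continuous_semigroup T by fact
  interpret S: strongly_continuous_semigroup S by fact
  obtain M where M: "M \<ge> 0" "\<And>s x. s \<in> {0..t} \<Longrightarrow> norm (T s x) \<le> M * norm x"
    using T.locally_bounded by blast
  txt \<open>For \<open>x\<close> in the domain, \<open>s \<mapsto> T (t - s) (S s x)\<close> has right derivative \<open>0\<close>.\<close>
  have eq: "T t x = S t x" if "has_generator_value S x y" for x y
  proof -
    define f where "f s = T (t - s) (S s x)" for s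
    have diff: "T r (u - v) = T r u - T r v" if "0 \<le> r" for r u v
      using bounded_linear.linear[OF T.bounded_linear[OF that]] by (rule linear_diff)
    have "f t = f 0"
    proof (rule right_derivative_zero_constant[OF t])
      show "continuous_on {0..t} f"
        unfolding continuous_on_def
      proof
        fix s assume s: "s \<in> {0..t}"
        \<comment> \<open>\<open>f r\<close> is split into \<open>T (t - r)\<close> at
          \<open>S r x - S s x\<close>, controlled by the uniform bound \<open>M\<close>, and at the
          fixed vector \<open>S s x\<close>, where strong continuity applies.\<close>
        have "((\<lambda>r. S r x) \<longlongrightarrow> S s x) (at s within {0..t})"
          using S.continuous_orbit[of 0 t x] s by (simp add: continuous_on_def)
        then have "((\<lambda>r. M * norm (S r x - S s x)) \<longlongrightarrow> M * norm (S s x - S s x)) (at s within {0..t})"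
          by (intro tendsto_intros)
        then have lim: "((\<lambda>r. M * norm (S r x - S s x)) \<longlongrightarrow> 0) (at s within {0..t})"
          by simp
        have "\<forall>\<^sub>F r in at s within {0..t}.
            norm (T (t - r) (S r x - S s x)) \<le> M * norm (S r x - S s x)"
          unfolding eventually_at_filter by (intro always_eventually allI impI M) auto
        then have "((\<lambda>r. T (t - r) (S r x - S s x)) \<longlongrightarrow> 0) (at s within {0..t})"
          using lim by (rule Lim_null_comparison)
        moreover have "continuous_on {0..t} (\<lambda>r. T (t - r) (S s x))"
          by (rule continuous_on_compose2[OF T.continuous_orbit[of 0 t]]) (auto intro!: continuous_intros)
        then have "((\<lambda>r. T (t - r) (S s x)) \<longlongrightarrow> f s) (at s within {0..t})"
          using s by (simp add: continuous_on_def f_def)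
        ultimately have "((\<lambda>r. T (t - r) (S r x - S s x) + T (t - r) (S s x)) \<longlongrightarrow> 0 + f s)
            (at s within {0..t})"
          by (rule tendsto_add)
        then show "(f \<longlongrightarrow> f s) (at s within {0..t})"
          unfolding add_0
        proof (rule Lim_transform_eventually)
          show "\<forall>\<^sub>F r in at s within {0..t}. T (t - r) (S r x - S s x) + T (t - r) (S s x) = f r"
            unfolding eventually_at_filter
            by (intro always_eventually allI impI) (simp add: f_def diff)
        qed
      qed
      fix s assume s: "0 \<le> s" "s < t"
      define z where "z = S s x"
      have "has_generator_value S z (S s y)" unfolding z_def using that s(1) by (rule S.has_generator_value_orbit)
      \<comment> \<open>By \<open>gen\<close> both difference quotients at \<open>z\<close> have the
        limit \<open>S s y\<close>.\<close>
      then have "((\<lambda>h. (S h z - z) /\<^sub>R h - (T h z - z) /\<^sub>R h) \<longlongrightarrow> S s y - S s y) (at_right 0)"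
        using gen[of z "S s y"] unfolding has_generator_value_def by (intro tendsto_diff)
      then have "((\<lambda>h. (S h z - T h z) /\<^sub>R h) \<longlongrightarrow> 0) (at_right 0)"
        by (simp flip: scaleR_diff_right)
      then have lim: "((\<lambda>h. M * norm ((S h z - T h z) /\<^sub>R h)) \<longlongrightarrow> 0) (at_right 0)"
        using tendsto_mult_right_zero tendsto_norm_zero by blast
      \<comment> \<open>Factoring \<open>T (t - (s + h))\<close> out of both values of
        \<open>f\<close> leaves the difference of the two short-time evolutions of
        \<open>z\<close>.\<close>
      have bd: "norm ((f (s + h) - f s) /\<^sub>R h) \<le> M * norm ((S h z - T h z) /\<^sub>R h)"
        if h: "0 < h" "h < t - s" for h
      proof -
        have "f s = T (t - (s + h)) (T h z)"
          using T.plus[of "t - (s + h)" h z] h s by (simp add: f_def z_def)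
        moreover have "f (s + h) = T (t - (s + h)) (S h z)"
          using S.plus[of h s x] h s by (simp add: f_def z_def add.commute)
        ultimately have "f (s + h) - f s = T (t - (s + h)) (S h z - T h z)"
          using h by (simp add: diff)
        then have "norm (f (s + h) - f s) \<le> M * norm (S h z - T h z)"
          using M(2)[of "t - (s + h)"] h s by simp
        then have "inverse h * norm (f (s + h) - f s) \<le> inverse h * (M * norm (S h z - T h z))"
          by (rule mult_left_mono) (use h in simp)
        then show ?thesis
          using h by (simp add: mult.left_commute)
      qed
      show "((\<lambda>h. (f (s + h) - f s) /\<^sub>R h) \<longlongrightarrow> 0) (at_right 0)"
      proof (rule Lim_null_comparison[OF _ lim])
        have "\<forall>\<^sub>F h in at_right 0. h \<in> {0<..<t - s}"
          using s by (intro eventually_at_right_real) simp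
        then show "\<forall>\<^sub>F h in at_right 0.
            norm ((f (s + h) - f s) /\<^sub>R h) \<le> M * norm ((S h z - T h z) /\<^sub>R h)"
          by eventually_elim (use bd in auto)
      qed
    qed
    then show ?thesis by (simp add: f_def)
  qed
  have "closed {x. T t x = S t x}"
    by (intro closed_Collect_eq linear_continuous_on T.bounded_linear S.bounded_linear t)
  then have "closure {x. \<exists>y. has_generator_value S x y} \<subseteq> {x. T t x = S t x}"
    using eq by (intro closure_minimal) auto
  then show ?thesis using S.dense_generator_domain by auto
qed

subsection \<open>The operator matrix\<close>

lemma (in normed_space_over) bounded_linear_scale: "bounded_linear (scale c)"
proof (rule bounded_linear_intro)
  show "scale c (r *\<^sub>R x) = r *\<^sub>R scale c x" for r x
    using scale_left_commute[of c "of_real r" x] by (simp only: scale_of_real)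
  show "norm (scale c x) \<le> norm x * norm c" for x
    by (simp add: norm_scale mult.commute)
qed (rule scale_right_distrib)

text \<open>Real homogeneity is the case \<open>c = of_real r\<close> of homogeneity over
  \<open>'k\<close>. The splitting makes real analysis available and leaves the scalar field as a
  purely algebraic condition.\<close>

lemma bounded_operator_iff:
  assumes "normed_space_over sX" "normed_space_over sY"
  shows "bounded_operator sX sY B \<longleftrightarrow> bounded_linear B \<and> (\<forall>c x. B (sX c x) = sY c (B x))"
proof -
  interpret X: normed_space_over sX by fact
  interpret Y: normed_space_over sY by fact
  show ?thesis
  proof
    assume B: "bounded_operator sX sY B"
    then interpret B: Vector_Spaces.linear sX sY B by (simp add: bounded_operator_def)
    have "B (r *\<^sub>R x) = r *\<^sub>R B x" for r x
      using B.scale[of "of_real r" x] by (simp add: X.scale_of_real Y.scale_of_real)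
    moreover obtain K where "\<And>x. norm (B x) \<le> K * norm x"
      using B by (auto simp: bounded_operator_def)
    ultimately have "bounded_linear B"
      by (intro bounded_linear_intro[of B K] B.add) (simp_all add: mult.commute)
    then show "bounded_linear B \<and> (\<forall>c x. B (sX c x) = sY c (B x))" using B.scale by simp
  next
    assume B: "bounded_linear B \<and> (\<forall>c x. B (sX c x) = sY c (B x))"
    then interpret B: bounded_linear B by simp
    have "Vector_Spaces.linear sX sY B"
      by unfold_locales (use B in \<open>simp_all add: B.add\<close>)
    then show "bounded_operator sX sY B"
      using B.bounded by (auto simp: bounded_operator_def mult.commute)
  qed
qed

lemma C0_semigroup_iff:
  assumes "normed_space_over sX"
  shows "C0_semigroup sX T \<longleftrightarrow> strongly_continuous_semigroup T \<and>
    (\<forall>t\<ge>0. \<forall>c x. T t (sX c x) = sX c (T t x))"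
  unfolding C0_semigroup_def strongly_continuous_semigroup_def bounded_operator_iff[OF assms assms]
  by blast

text \<open>Uniqueness of limits merges the equation for the domain and the values of the generator
  into a description of its graph.\<close>

lemma generates_iff:
  assumes "normed_space_over sX"
  shows "generates sX D A T \<longleftrightarrow> strongly_continuous_semigroup T \<and>
    (\<forall>t\<ge>0. \<forall>c x. T t (sX c x) = sX c (T t x)) \<and>
    (\<forall>x y. has_generator_value T x y \<longleftrightarrow> x \<in> D \<and> y = A x)"
proof -
  have "(D = {x. \<exists>y. has_generator_value T x y} \<and> (\<forall>x\<in>D. has_generator_value T x (A x))) \<longleftrightarrow>
      (\<forall>x y. has_generator_value T x y \<longleftrightarrow> x \<in> D \<and> y = A x)" if "strongly_continuous_semigroup T"
    using strongly_continuous_semigroup.has_generator_value_unique[OF that] by blast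
  then show ?thesis
    unfolding generates_def C0_semigroup_iff[OF assms] has_generator_value_def[symmetric] by blast
qed

locale boundary_operator =
  X: normed_space_over sX + Y: normed_space_over sY
  for sX :: "'k::real_normed_field \<Rightarrow> 'x::banach \<Rightarrow> 'x"
    and sY :: "'k \<Rightarrow> 'y::banach \<Rightarrow> 'y" +
  fixes D :: "'x set" and A :: "'x \<Rightarrow> 'x" and L :: "'x \<Rightarrow> 'y"
  assumes A: "linear_operator sX sX D A" and L: "linear_operator sX sY D L"
    and surj: "L ` D = UNIV"
    and closed: "closed_operator D (\<lambda>u. (A u, L u))"
begin

interpretation P: vector_space_prod sX sY ..

lemma normed_space_over_scales:
  "normed_space_over sX" "normed_space_over sY" "normed_space_over P.scale"
  using X.normed_space_over_axioms Y.normed_space_over_axioms normed_space_over_prod by auto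

lemma subspace_D: "X.subspace D"
  and A_add: "u \<in> D \<Longrightarrow> v \<in> D \<Longrightarrow> A (u + v) = A u + A v"
  and L_add: "u \<in> D \<Longrightarrow> v \<in> D \<Longrightarrow> L (u + v) = L u + L v"
  and A_scale: "u \<in> D \<Longrightarrow> A (sX c u) = sX c (A u)"
  and L_scale: "u \<in> D \<Longrightarrow> L (sX c u) = sY c (L u)"
  using A L by (auto simp: linear_operator_def)

lemma diff_D: "u \<in> D \<Longrightarrow> v \<in> D \<Longrightarrow> u - v \<in> D"
  and A_diff: "u \<in> D \<Longrightarrow> v \<in> D \<Longrightarrow> A (u - v) = A u - A v"
  and L_diff: "u \<in> D \<Longrightarrow> v \<in> D \<Longrightarrow> L (u - v) = L u - L v"
  using X.subspace_diff[OF subspace_D] A_add[of "u - v" v] L_add[of "u - v" v] by auto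

lemma mem_kernel_iff: "u \<in> operator_kernel D L \<longleftrightarrow> u \<in> D \<and> L u = 0"
  by (simp add: operator_kernel_def)

section \<open>The Dirichlet operator at a fixed point of the resolvent set\<close>

context
  fixes \<mu> :: 'k
  assumes res: "\<mu> \<in> resolvent_set sX (operator_kernel D L) A"
begin

abbreviation "dir \<equiv> dirichlet_operator sX D A L \<mu>"

lemma bij_L: "bij_betw L (operator_kernel D (\<lambda>u. sX \<mu> u - A u)) UNIV"
  by (rule bij_betw_dirichlet[OF normed_space_over_scales(1,2) A L surj res])

lemma dir_D: "dir v \<in> D"
  and A_dir: "A (dir v) = sX \<mu> (dir v)"
  and L_dir: "L (dir v) = v"
proof -
  have "dir v \<in> operator_kernel D (\<lambda>u. sX \<mu> u - A u)"
    unfolding dirichlet_operator_def using bij_L by (intro the_inv_into_into) (auto simp: bij_betw_def)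
  then show "dir v \<in> D" "A (dir v) = sX \<mu> (dir v)" by (auto simp: operator_kernel_def)
  show "L (dir v) = v"
    unfolding dirichlet_operator_def using bij_L by (intro f_the_inv_into_f_bij_betw) auto
qed

text \<open>Injectivity of \<open>L\<close> on the kernel of \<open>\<mu> - A\<close>; linearity and
  closedness of \<open>dir\<close> are read off from it.\<close>

lemma dir_eqI: "u \<in> D \<Longrightarrow> A u = sX \<mu> u \<Longrightarrow> L u = v \<Longrightarrow> dir v = u"
  unfolding dirichlet_operator_def using bij_L
  by (intro the_inv_into_f_eq) (auto simp: operator_kernel_def bij_betw_def)

lemma dir_scale: "dir (sY c v) = sX c (dir v)"
  using X.subspace_scale[OF subspace_D dir_D]
  by (intro dir_eqI) (auto simp: dir_D A_dir L_dir A_scale L_scale X.scale_left_commute)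

text \<open>On the range of \<open>dir\<close> the operator \<open>A\<close> is multiplication by
  \<open>\<mu>\<close>, so convergence of \<open>dir v\<close> along a sequence forces convergence
  of \<open>A (dir v)\<close>. Closedness of the pair of \<open>A\<close> and \<open>L\<close>
  therefore closes the graph of \<open>dir\<close>.\<close>

lemma bounded_linear_dir: "bounded_linear dir"
proof (rule closed_graph_theorem)
  have "dir (u + v) = dir u + dir v" for u v
    using X.subspace_add[OF subspace_D dir_D dir_D]
    by (intro dir_eqI) (auto simp: dir_D A_dir L_dir A_add L_add X.scale_right_distrib)
  moreover have "dir (r *\<^sub>R v) = r *\<^sub>R dir v" for r v
    using dir_scale[of "of_real r" v] by (simp add: X.scale_of_real Y.scale_of_real)
  ultimately show "linear dir" by (rule linearI)
  show "closed (range (\<lambda>v. (v, dir v)))"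
    unfolding closed_sequential_limits
  proof (intro allI impI, elim conjE)
    fix p l assume p: "\<forall>n. p n \<in> range (\<lambda>v. (v, dir v))" and lim: "p \<longlonglongrightarrow> l"
    have snd: "snd (p n) = dir (fst (p n))" for n using p[rule_format, of n] by auto
    have f: "(\<lambda>n. fst (p n)) \<longlonglongrightarrow> fst l" and s: "(\<lambda>n. snd (p n)) \<longlonglongrightarrow> snd l"
      using tendsto_fst[OF lim] tendsto_snd[OF lim] by simp_all
    have "(\<lambda>n. (snd (p n), (sX \<mu> (snd (p n)), fst (p n)))) \<longlonglongrightarrow> (snd l, (sX \<mu> (snd l), fst l))"
      by (intro tendsto_Pair f s bounded_linear.tendsto[OF X.bounded_linear_scale])
    moreover have "(snd (p n), (sX \<mu> (snd (p n)), fst (p n))) \<in> (\<lambda>u. (u, (A u, L u))) ` D" for n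
      unfolding snd by (intro image_eqI[of _ _ "dir (fst (p n))"]) (auto simp: dir_D A_dir L_dir)
    ultimately have "(snd l, (sX \<mu> (snd l), fst l)) \<in> (\<lambda>u. (u, (A u, L u))) ` D"
      by (rule closed_sequentially[OF closed[unfolded closed_operator_def], rotated])
    then obtain u where "u \<in> D" "snd l = u" "sX \<mu> (snd l) = A u" "fst l = L u"
      by (elim imageE) simp
    then have "dir (fst l) = snd l" using dir_eqI[of u "fst l"] by metis
    then show "l \<in> range (\<lambda>v. (v, dir v))" by (intro image_eqI[of _ _ "fst l"]) (simp_all add: prod_eq_iff)
  qed
qed

section \<open>The semigroup of the operator matrix, given a semigroup generated by the restriction
  of \<open>A\<close>\<close>

context
  fixes T :: "real \<Rightarrow> 'x \<Rightarrow> 'x"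
  assumes gen: "generates sX (operator_kernel D L) A T"
begin

interpretation T: strongly_continuous_semigroup T
  using gen by (simp add: generates_iff[OF normed_space_over_scales(1)])

lemma T_scale: "0 \<le> t \<Longrightarrow> T t (sX c x) = sX c (T t x)"
  and has_generator_value_T: "has_generator_value T x y \<longleftrightarrow> x \<in> operator_kernel D L \<and> y = A x"
  using gen by (simp_all add: generates_iff[OF normed_space_over_scales(1)])

lemma integral_T_scale:
  "integral {0..t} (\<lambda>s. T s (sX c x)) = sX c (integral {0..t} (\<lambda>s. T s x))"
proof -
  have "integral {0..t} (\<lambda>s. T s (sX c x)) = integral {0..t} (sX c \<circ> (\<lambda>s. T s x))"
    by (rule Henstock_Kurzweil_Integration.integral_cong) (simp add: T_scale)
  then show ?thesis
    by (simp add: integral_linear[OF T.integrable_orbit X.bounded_linear_scale])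
qed

text \<open>The bracket is \<open>\<mu> - A\<close> applied to the orbit integral of
  \<open>dir (snd p)\<close>, with the value of \<open>A\<close> there taken from
  \<open>T.has_generator_value_integral\<close>.\<close>

definition matrix_semigroup :: "real \<Rightarrow> 'x \<times> 'y \<Rightarrow> 'x \<times> 'y"
  where "matrix_semigroup t p =
    (T t (fst p) + (dir (snd p) - T t (dir (snd p)) +
      sX \<mu> (integral {0..t} (\<lambda>s. T s (dir (snd p))))), snd p)"

lemma matrix_semigroup_strongly_continuous: "strongly_continuous_semigroup matrix_semigroup"
proof (rule strongly_continuous_semigroup.intro)
  fix t :: real assume t: "0 \<le> t"
  note T = T.bounded_linear[OF t]
  have dir: "bounded_linear (\<lambda>p. dir (snd p))"
    by (intro bounded_linear_compose[OF bounded_linear_dir] bounded_linear_snd)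
  show "bounded_linear (matrix_semigroup t)"
    unfolding matrix_semigroup_def
    by (intro bounded_linear_Pair bounded_linear_add bounded_linear_sub bounded_linear_snd dir
      bounded_linear_compose[OF T bounded_linear_fst] bounded_linear_compose[OF T dir]
      bounded_linear_compose[OF X.bounded_linear_scale]
      bounded_linear_compose[OF T.bounded_linear_integral_orbit dir])
next
  fix p :: "'x \<times> 'y" show "matrix_semigroup 0 p = p" by (simp add: matrix_semigroup_def)
next
  fix s t :: real and p :: "'x \<times> 'y" assume s: "0 \<le> s" and t: "0 \<le> t"
  interpret Ts: bounded_linear "T s" using s by (rule T.bounded_linear)
  let ?I = "\<lambda>a b. integral {a..b} (\<lambda>r. T r (dir (snd p)))"
  \<comment> \<open>The upper right entry needs \<open>Q(s + t) = T(s) Q(t) + Q(s)\<close>: the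
    integrals over \<open>{0..s}\<close> and \<open>{s..s + t}\<close> combine, and the terms
    \<open>T s (dir (snd p))\<close> cancel.\<close>
  have "T s (?I 0 t) = ?I s (s + t)" using T.apply_integral[OF s, of 0 t] by (simp add: add.commute)
  moreover have "?I 0 (s + t) = ?I 0 s + ?I s (s + t)"
    using T.integral_combine_orbit s t by simp
  ultimately show "matrix_semigroup (s + t) p = matrix_semigroup s (matrix_semigroup t p)"
    using s t
    by (simp add: matrix_semigroup_def T.plus Ts.add Ts.diff T_scale X.scale_right_distrib)
next
  fix p :: "'x \<times> 'y" show "continuous_on {0..} (\<lambda>t. matrix_semigroup t p)"
    unfolding matrix_semigroup_def
    by (intro continuous_intros T.continuous T.continuous_on_integral_orbit
      bounded_linear.continuous_on[OF X.bounded_linear_scale])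
qed

lemma has_generator_value_matrix_semigroup:
  "has_generator_value matrix_semigroup (u, v) y \<longleftrightarrow>
    snd y = 0 \<and> has_generator_value T (u - dir v) (fst y - sX \<mu> (dir v))"
proof -
  define w where "w = u - dir v"
  \<comment> \<open>\<open>J h\<close> is what remains of the quotient once
    \<open>dir v - T h (dir v)\<close> is merged with \<open>T h u - u\<close>. The form
    \<open>0 + h\<close> matches \<open>tendsto_average\<close> at time \<open>0\<close>.\<close>
  define J where "J h = sX \<mu> (integral {0..0 + h} (\<lambda>s. T s (dir v)) /\<^sub>R h)" for h
  have J: "(J \<longlongrightarrow> sX \<mu> (dir v)) (at_right 0)"
    unfolding J_def
    using bounded_linear.tendsto[OF X.bounded_linear_scale T.tendsto_average[of 0 "dir v"]] by simp
  have eq: "(matrix_semigroup h (u, v) - (u, v)) /\<^sub>R h = ((T h w - w) /\<^sub>R h + J h, 0)" if "h > 0" for h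
  proof -
    interpret Th: bounded_linear "T h" using that by (intro T.bounded_linear) simp
    interpret S: bounded_linear "sX \<mu>" by (rule X.bounded_linear_scale)
    show ?thesis by (simp add: matrix_semigroup_def w_def J_def Th.diff S.scale algebra_simps)
  qed
  have "has_generator_value matrix_semigroup (u, v) y \<longleftrightarrow>
      ((\<lambda>h. ((T h w - w) /\<^sub>R h + J h, 0)) \<longlongrightarrow> y) (at_right 0)"
    unfolding has_generator_value_def
    by (rule tendsto_cong) (use eq in \<open>auto intro: eventually_mono[OF eventually_at_right_less[of 0]]\<close>)
  also have "\<dots> \<longleftrightarrow> ((\<lambda>h. (T h w - w) /\<^sub>R h + J h) \<longlongrightarrow> fst y) (at_right 0) \<and> snd y = 0"
  proof safe
    assume lim: "((\<lambda>h. ((T h w - w) /\<^sub>R h + J h, 0)) \<longlongrightarrow> y) (at_right 0)"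
    show "((\<lambda>h. (T h w - w) /\<^sub>R h + J h) \<longlongrightarrow> fst y) (at_right 0)"
      using tendsto_fst[OF lim] by simp
    show "snd y = 0"
      using tendsto_snd[OF lim] by (simp add: tendsto_const_iff)
  next
    assume "((\<lambda>h. (T h w - w) /\<^sub>R h + J h) \<longlongrightarrow> fst y) (at_right 0)" "snd y = 0"
    then have "((\<lambda>h. ((T h w - w) /\<^sub>R h + J h, 0)) \<longlongrightarrow> (fst y, snd y)) (at_right 0)"
      by (intro tendsto_Pair) simp_all
    then show "((\<lambda>h. ((T h w - w) /\<^sub>R h + J h, 0)) \<longlongrightarrow> y) (at_right 0)" by simp
  qed
  also have "((\<lambda>h. (T h w - w) /\<^sub>R h + J h) \<longlongrightarrow> fst y) (at_right 0) \<longleftrightarrow>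
      has_generator_value T w (fst y - sX \<mu> (dir v))"
    unfolding has_generator_value_def
  proof
    assume lim: "((\<lambda>h. (T h w - w) /\<^sub>R h + J h) \<longlongrightarrow> fst y) (at_right 0)"
    show "((\<lambda>h. (T h w - w) /\<^sub>R h) \<longlongrightarrow> fst y - sX \<mu> (dir v)) (at_right 0)"
      using tendsto_diff[OF lim J] by simp
  next
    assume lim: "((\<lambda>h. (T h w - w) /\<^sub>R h) \<longlongrightarrow> fst y - sX \<mu> (dir v)) (at_right 0)"
    show "((\<lambda>h. (T h w - w) /\<^sub>R h + J h) \<longlongrightarrow> fst y) (at_right 0)"
      using tendsto_add[OF lim J] by simp
  qed
  finally show ?thesis by (auto simp: w_def)
qed

lemma generates_matrix_semigroup:
  "generates P.scale (matrix_domain D L) (matrix_operator A) matrix_semigroup"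
  unfolding generates_iff[OF normed_space_over_scales(3)]
proof (intro conjI allI impI)
  show "strongly_continuous_semigroup matrix_semigroup"
    by (rule matrix_semigroup_strongly_continuous)
next
  fix t :: real and c p assume "0 \<le> t"
  then show "matrix_semigroup t (P.scale c p) = P.scale c (matrix_semigroup t p)"
    by (simp add: matrix_semigroup_def P.scale_def dir_scale T_scale integral_T_scale
      X.scale_right_distrib X.scale_right_diff_distrib X.scale_left_commute)
next
  fix p y :: "'x \<times> 'y"
  obtain u v where p: "p = (u, v)" by (cases p)
  have "u - dir v \<in> D \<longleftrightarrow> u \<in> D"
    using diff_D[OF _ dir_D, of u v] X.subspace_add[OF subspace_D _ dir_D, of "u - dir v" v] by auto
  then have "u - dir v \<in> operator_kernel D L \<longleftrightarrow> p \<in> matrix_domain D L"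
    by (auto simp: mem_kernel_iff matrix_domain_def p L_diff dir_D L_dir)
  \<comment> \<open>The correction \<open>sX \<mu> (dir v)\<close> is the one in
    \<open>has_generator_value_matrix_semigroup\<close>, so the generator has first component
    \<open>A u\<close>.\<close>
  moreover have "A (u - dir v) = A u - sX \<mu> (dir v)" if "p \<in> matrix_domain D L"
    using that by (simp add: matrix_domain_def p A_diff dir_D A_dir)
  ultimately show "has_generator_value matrix_semigroup p y \<longleftrightarrow>
      p \<in> matrix_domain D L \<and> y = matrix_operator A p"
    by (auto simp: p has_generator_value_matrix_semigroup has_generator_value_T matrix_operator_def prod_eq_iff)
qed

text \<open>The first fact makes \<open>(\<mu> - A) (w v)\<close> a value of the restricted
  operator; the second removes the integral when \<open>\<mu> = 0\<close>.\<close>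

lemma semigroup_of_matrix_operator:
  assumes TT: "generates P.scale (matrix_domain D L) (matrix_operator A) TT" and t: "0 \<le> t"
  defines "w \<equiv> \<lambda>v. integral {0..t} (\<lambda>s. T s (dir v))"
  shows "w v \<in> operator_kernel D L"
    and "A (w v) = T t (dir v) - dir v"
    and "TT t (u, v) = (T t u + (sX \<mu> (w v) - A (w v)), v)"
proof -
  show w: "w v \<in> operator_kernel D L" and Aw: "A (w v) = T t (dir v) - dir v"
    using T.has_generator_value_integral[OF t, of "dir v"] by (simp_all add: has_generator_value_T w_def)
  have "TT t (u, v) = matrix_semigroup t (u, v)"
    using TT generates_matrix_semigroup t
    unfolding generates_iff[OF normed_space_over_scales(3)]
    by (intro semigroup_determined_by_generator[of TT matrix_semigroup]) blast+
  then show "TT t (u, v) = (T t u + (sX \<mu> (w v) - A (w v)), v)"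
    using Aw by (simp add: matrix_semigroup_def w_def)
qed

end

end

section \<open>The semigroup on the first factor induced by the operator matrix\<close>

lemma generates_kernel_of_matrix:
  assumes TT: "generates P.scale (matrix_domain D L) (matrix_operator A) TT"
  shows "generates sX (operator_kernel D L) A (\<lambda>t u. fst (TT t (u, 0)))"
proof -
  interpret TT: strongly_continuous_semigroup TT
    using TT by (simp add: generates_iff[OF normed_space_over_scales(3)])
  have TT_scale: "TT t (P.scale c p) = P.scale c (TT t p)" if "0 \<le> t" for t c p
    using TT that unfolding generates_iff[OF normed_space_over_scales(3)] by blast
  have has_generator_value_TT: "has_generator_value TT p y \<longleftrightarrow> p \<in> matrix_domain D L \<and> y = matrix_operator A p" for p y
    using TT unfolding generates_iff[OF normed_space_over_scales(3)] by blast
  define T where "T t u = fst (TT t (u, 0))" for t u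
  have "snd (TT t p) = snd p" if "0 \<le> t" for t p
  proof -
    \<comment> \<open>\<open>TT t p - p\<close> is the image under the matrix of the orbit integral,
      and the second row of the matrix is zero.\<close>
    have "snd (TT t p - p) = 0"
      using TT.has_generator_value_integral[OF that, of p]
      by (auto simp: has_generator_value_TT matrix_operator_def split: prod.splits)
    then show ?thesis by simp
  qed
  then have TT_eq: "TT t (u, 0) = (T t u, 0)" if "0 \<le> t" for t u
    using that by (simp add: T_def prod_eq_iff)
  have "strongly_continuous_semigroup T"
  proof (rule strongly_continuous_semigroup.intro)
    show "bounded_linear (T t)" if "0 \<le> t" for t
      unfolding T_def using that
      by (intro bounded_linear_compose[OF bounded_linear_fst] bounded_linear_compose[OF TT.bounded_linear]
        bounded_linear_Pair bounded_linear_ident bounded_linear_zero)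
    show "T 0 u = u" for u by (simp add: T_def)
    show "T (s + t) u = T s (T t u)" if "0 \<le> s" "0 \<le> t" for s t u
      using TT.plus[OF that, of "(u, 0)"] that by (simp add: TT_eq)
    show "continuous_on {0..} (\<lambda>t. T t u)" for u
      unfolding T_def by (intro continuous_intros TT.continuous)
  qed
  moreover have "T t (sX c u) = sX c (T t u)" if "0 \<le> t" for t c u
    using TT_scale[OF that, of c "(u, 0)"] that by (simp add: TT_eq P.scale_prod)
  moreover have "has_generator_value T u y \<longleftrightarrow> u \<in> operator_kernel D L \<and> y = A u" for u y
  proof -
    \<comment> \<open>By \<open>TT_eq\<close> the quotients at \<open>(u, 0)\<close> have second
      component \<open>0\<close>, so their convergence is decided by the first.\<close>
    have "has_generator_value TT (u, 0) (y, 0) \<longleftrightarrow> ((\<lambda>h. ((T h u - u) /\<^sub>R h, 0::'y)) \<longlongrightarrow> (y, 0)) (at_right 0)"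
      unfolding has_generator_value_def
      by (rule tendsto_cong) (auto simp: TT_eq intro: eventually_mono[OF eventually_at_right_less[of 0]])
    also have "\<dots> \<longleftrightarrow> has_generator_value T u y"
      unfolding has_generator_value_def using tendsto_fst[of "\<lambda>h. ((T h u - u) /\<^sub>R h, 0::'y)" "(y, 0)"]
      by (auto intro: tendsto_Pair)
    finally show ?thesis
      by (auto simp: has_generator_value_TT matrix_domain_def matrix_operator_def mem_kernel_iff)
  qed
  ultimately show ?thesis
    unfolding generates_iff[OF normed_space_over_scales(1)] T_def[symmetric] by blast
qed

end

text \<open>The membership of \<open>w\<close> in the kernel makes \<open>sX \<mu> w - A w\<close>
  the vector \<open>Q(t) v\<close>; as \<open>TT\<close> and \<open>T\<close> are fixed before
  \<open>\<mu>\<close>, the independence of \<open>Q(t)\<close> from \<open>\<mu>\<close> is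
  included.\<close>

theorem theorem3p6:
  fixes sX :: "'k::real_normed_field \<Rightarrow> 'x::banach \<Rightarrow> 'x"
    and sY :: "'k \<Rightarrow> 'y::banach \<Rightarrow> 'y"
    and D :: "'x set" and A :: "'x \<Rightarrow> 'x" and L :: "'x \<Rightarrow> 'y"
  assumes "normed_space_over sX" and "normed_space_over sY"
    and "linear_operator sX sX D A" and "linear_operator sX sY D L"
    and G1: "closed_operator (operator_kernel D L) A"
      "closure (operator_kernel D L) = UNIV"
      "resolvent_set sX (operator_kernel D L) A \<noteq> {}"
    and G2: "L ` D = UNIV"
    and G3: "closed_operator D (\<lambda>u. (A u, L u))"
  shows "((\<exists>TT. generates (module_prod.scale sX sY) (matrix_domain D L) (matrix_operator A) TT)
            \<longleftrightarrow> (\<exists>T. generates sX (operator_kernel D L) A T)) \<and>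
    (\<forall>TT T. generates (module_prod.scale sX sY) (matrix_domain D L) (matrix_operator A) TT \<longrightarrow>
        generates sX (operator_kernel D L) A T \<longrightarrow>
      (\<forall>\<mu>\<in>resolvent_set sX (operator_kernel D L) A. \<forall>t\<ge>0. \<forall>u v.
        let w = integral {0..t} (\<lambda>s. T s (dirichlet_operator sX D A L \<mu> v))
        in w \<in> operator_kernel D L \<and> TT t (u, v) = (T t u + (sX \<mu> w - A w), v)) \<and>
      (0 \<in> resolvent_set sX (operator_kernel D L) A \<longrightarrow> (\<forall>t\<ge>0. \<forall>u v.
        TT t (u, v) =
          (T t u + (dirichlet_operator sX D A L 0 v - T t (dirichlet_operator sX D A L 0 v)), v))))"
proof -
  interpret boundary_operator sX sY D A L
    using assms by (simp add: boundary_operator_def boundary_operator_axioms_def)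
  show ?thesis
  proof (intro conjI allI ballI impI)
    show "(\<exists>TT. generates (module_prod.scale sX sY) (matrix_domain D L) (matrix_operator A) TT)
        \<longleftrightarrow> (\<exists>T. generates sX (operator_kernel D L) A T)"
      \<comment> \<open>Building \<open>matrix_semigroup\<close> takes a point of the resolvent set,
        which (G1) supplies.\<close>
      using G1(3) generates_kernel_of_matrix generates_matrix_semigroup by blast
  next
    fix TT T \<mu> u v and t :: real
    assume "generates (module_prod.scale sX sY) (matrix_domain D L) (matrix_operator A) TT"
      and "generates sX (operator_kernel D L) A T"
      and "\<mu> \<in> resolvent_set sX (operator_kernel D L) A" and "0 \<le> t"
    then show "let w = integral {0..t} (\<lambda>s. T s (dirichlet_operator sX D A L \<mu> v))
        in w \<in> operator_kernel D L \<and> TT t (u, v) = (T t u + (sX \<mu> w - A w), v)"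
      using semigroup_of_matrix_operator by (simp add: Let_def)
  next
    fix TT T u v and t :: real
    assume "generates (module_prod.scale sX sY) (matrix_domain D L) (matrix_operator A) TT"
      and "generates sX (operator_kernel D L) A T"
      and "0 \<in> resolvent_set sX (operator_kernel D L) A" and "0 \<le> t"
    then show "TT t (u, v) =
        (T t u + (dirichlet_operator sX D A L 0 v - T t (dirichlet_operator sX D A L 0 v)), v)"
      \<comment> \<open>At \<open>\<mu> = 0\<close> only \<open>- A w\<close> is left, which the
        second fact evaluates.\<close>
      using semigroup_of_matrix_operator(2,3)[of 0 T TT t] by simp
  qed
qed

end
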